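(* Let $K\subset[0,1]$ be the attractor of a homogeneous linear iterated function system $\{\phi_j(x)=\rho x+a_j\}_{j=1}^L$ satisfying the strong separation condition, let $\mu$ be the natural self-similar probability measure on $K$, let $T:K\to K$ be the map induced by the shift, and let $\gamma:=\dim_H K=\frac{\log L}{-\log\rho}$. Let $\alpha>0$. Then for $\mu$-almost every $x\in K$, $$\liminf_{n\to\infty}n^{1/\alpha}|T^nx-x|=\begin{cases}0, & \text{if } \alpha\ge\gamma;\\ \infty, & \text{if } \alpha<\gamma.\end{cases}$$
   Context: Setting. Let $L\ge 2$ be an integer, $\rho\in(0,1)$, and $0\le a_1<\cdots<a_L\le 1-\rho$. Put $\phi_j(x)=\rho x+a_j$ on $[0,1]$ for $1\le j\le L$. The attractor $K$ is the unique non-empty compact subset of $[0,1]$ with $K=\bigcup_{j=1}^L\phi_j(K)$. The strong separation condition means that the sets $\phi_1(K),\dots,\phi_L(K)$ are pairwise disjoint (as a consequence $\rho<1/L$). Coding. Let $\Lambda=\{1,\dots,L\}$. For $\epsilon=(\epsilon_1,\epsilon_2,\dots)\in\Lambda^{\mathbb{N}}$ let $\pi(\epsilon)$ be the unique point of $\bigcap_{n\ge1}\phi_{\epsilon_1}\circ\cdots\circ\phi_{\epsilon_n}([0,1])$. Then $K=\pi(\Lambda^{\mathbb{N}})$, and each $x\in K$ has a unique coding, i.e. a unique $\epsilon$ with $\pi(\epsilon)=x$. Map. $T:K\to K$ is defined by $Tx=\pi(\sigma(\epsilon))$ where $\epsilon$ is the coding of $x$ and $\sigma$ is the left shift on $\Lambda^{\mathbb{N}}$.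 Measure. $\mu$ is the unique Borel probability measure supported on $K$ with $\mu(A)=\frac1L\sum_{j=1}^L\mu(\phi_j^{-1}(A))$ for all Borel $A$. Here $\dim_H$ is Hausdorff dimension and $|\cdot|$ is the Euclidean metric. *)

theory Defs
  imports "HOL-Probability.Probability"
begin

(* The boundedness condition on the cover is needed because the real-valued library constant
   diameter is meaningful only on bounded sets. *)
definition hausdorff_pre :: "real \<Rightarrow> real \<Rightarrow> 'a::metric_space set \<Rightarrow> ennreal" where
  "hausdorff_pre \<delta> s A =
     (INF U \<in> {U :: nat \<Rightarrow> 'a set. A \<subseteq> (\<Union>i. U i) \<and> (\<forall>i. bounded (U i) \<and> diameter (U i) \<le> \<delta>)}.
        \<Sum>i. ennreal (diameter (U i) powr s))"

definition hausdorff_measure :: "real \<Rightarrow> 'a::metric_space set \<Rightarrow> ennreal" where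
  "hausdorff_measure s A = (SUP \<delta> \<in> {0<..}. hausdorff_pre \<delta> s A)"

(* The exponent s = 0 is left out, so the convention 0 powr 0 = 0 plays no role; this does not
   affect the infimum. The value is \<infinity> if there is no s with vanishing measure. *)
definition hausdorff_dim :: "'a::metric_space set \<Rightarrow> ereal" where
  "hausdorff_dim A = Inf {ereal s | s. 0 < s \<and> hausdorff_measure s A = 0}"

definition ifs_map :: "real \<Rightarrow> (nat \<Rightarrow> real) \<Rightarrow> nat \<Rightarrow> real \<Rightarrow> real" where
  "ifs_map \<rho> a j x = \<rho> * x + a j"

definition is_attractor :: "nat \<Rightarrow> (nat \<Rightarrow> real \<Rightarrow> real) \<Rightarrow> real set \<Rightarrow> bool" where
  "is_attractor L \<phi> K \<longleftrightarrow>
     K \<noteq> {} \<and> compact K \<and> K \<subseteq> {0..1} \<and> K = (\<Union>j\<in>{1..L}. \<phi> j ` K)"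

definition strong_separation :: "nat \<Rightarrow> (nat \<Rightarrow> real \<Rightarrow> real) \<Rightarrow> real set \<Rightarrow> bool" where
  "strong_separation L \<phi> K \<longleftrightarrow> disjoint_family_on (\<lambda>j. \<phi> j ` K) {1..L}"

(* The maps have domain [0,1], hence the intersection with {0..1} in the preimage. *)
definition is_natural_measure ::
    "nat \<Rightarrow> (nat \<Rightarrow> real \<Rightarrow> real) \<Rightarrow> real set \<Rightarrow> real measure \<Rightarrow> bool" where
  "is_natural_measure L \<phi> K \<mu> \<longleftrightarrow>
     prob_space \<mu> \<and> sets \<mu> = sets borel \<and> measure \<mu> K = 1 \<and>
     (\<forall>A\<in>sets borel.
        measure \<mu> A = (1 / real L) * (\<Sum>j=1..L. measure \<mu> (\<phi> j -` A \<inter> {0..1})))"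

(* Sequences are indexed from 0: the entry \<epsilon> n is the (n+1)-st letter of the code. *)
definition code_space :: "nat \<Rightarrow> (nat \<Rightarrow> nat) set" where
  "code_space L = {\<epsilon>. \<forall>n. \<epsilon> n \<in> {1..L}}"

primrec cylinder_map :: "(nat \<Rightarrow> real \<Rightarrow> real) \<Rightarrow> (nat \<Rightarrow> nat) \<Rightarrow> nat \<Rightarrow> real \<Rightarrow> real" where
  "cylinder_map \<phi> \<epsilon> 0 = id"
| "cylinder_map \<phi> \<epsilon> (Suc n) = cylinder_map \<phi> \<epsilon> n \<circ> \<phi> (\<epsilon> n)"

definition code_point :: "(nat \<Rightarrow> real \<Rightarrow> real) \<Rightarrow> (nat \<Rightarrow> nat) \<Rightarrow> real" where
  "code_point \<phi> \<epsilon> = (THE x. x \<in> (\<Inter>n\<in>{1..}. cylinder_map \<phi> \<epsilon> n ` {0..1}))"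

definition coding :: "nat \<Rightarrow> (nat \<Rightarrow> real \<Rightarrow> real) \<Rightarrow> real \<Rightarrow> nat \<Rightarrow> nat" where
  "coding L \<phi> x = (THE \<epsilon>. \<epsilon> \<in> code_space L \<and> code_point \<phi> \<epsilon> = x)"

definition left_shift :: "(nat \<Rightarrow> 'b) \<Rightarrow> nat \<Rightarrow> 'b" where
  "left_shift \<epsilon> = (\<lambda>n. \<epsilon> (Suc n))"

(* Meaningful only on the attractor, where codings exist and are unique. *)
definition shift_map :: "nat \<Rightarrow> (nat \<Rightarrow> real \<Rightarrow> real) \<Rightarrow> real \<Rightarrow> real" where
  "shift_map L \<phi> x = code_point \<phi> (left_shift (coding L \<phi> x))"

end

theory Submission
  imports Defs "HOL-Real_Asymp.Real_Asymp"
begin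

text \<open>
  Read \<open>x \<in> K\<close> through its code. Under \<open>\<mu>\<close> the letters of the code are independent and uniform on
  \<open>{1..L}\<close>, and \<open>T\<close> is the left shift. By strong separation, up to constants, \<open>|x - y| \<le> \<rho> ^ m\<close>
  means that the first \<open>m\<close> letters of \<open>x\<close> and \<open>y\<close> agree (\<open>dist_le_if_codes_agree\<close>,
  \<open>codes_agree_if_close\<close>). So the question is how long a piece of the initial word of the code is
  repeated from position \<open>n\<close> on. Put \<open>\<gamma> = ln L / (- ln \<rho>)\<close>, so that \<open>\<rho> powr \<gamma> = 1 / L\<close>.

  The computation behind both halves of the dichotomy is \<open>code_prob_returns\<close>: for every \<open>n > 0\<close>,
  the event that the \<open>l\<close> letters from position \<open>n\<close> on repeat the first \<open>l\<close> letters has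
  probability \<open>L ^ (-l)\<close> and is independent of the first \<open>n\<close> letters. Indeed, revealing the letters
  one after the other, the letter at position \<open>n + i\<close> is fresh when it is compared with the letter
  at position \<open>i\<close>, even if the two words overlap.

  If \<open>\<alpha> < \<gamma>\<close>, then \<open>|T ^ n x - x| \<le> C * n powr (-1/\<alpha>)\<close> forces a repetition whose probability is
  of order \<open>n powr (-\<gamma>/\<alpha>)\<close>. This is summable, and by the Borel--Cantelli lemma it happens only
  finitely often for every \<open>C\<close>.

  The case \<open>\<alpha> \<ge> \<gamma>\<close> follows from \<open>\<alpha> = \<gamma>\<close>, where the probabilities are of order \<open>1 / n\<close>, so the series
  only just diverges. Repetition events over disjoint blocks of positions are exactly independent by
  the computation above. Filling the positions greedily with blocks
  of length about \<open>k + log L n\<close> still gives a divergent series, like the sum of \<open>1 / (j * ln j)\<close>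
  (\<open>block_sum_diverges\<close>), so almost surely some block beyond any given position is a repetition
  (\<open>AE_some_return\<close>). There \<open>n powr (1/\<gamma>) * |T ^ n x - x| \<le> \<rho> ^ (k - 1)\<close>, and \<open>k\<close> is arbitrary.

  The same estimates give the dimension: covering \<open>K\<close> by its \<open>L ^ n\<close> cylinders bounds it from above,
  and \<open>\<mu> V \<le> C * diameter V powr \<gamma>\<close> (\<open>measure_closed_le\<close>) bounds it from below.
\<close>

section \<open>Coding the points of the attractor\<close>

locale homogeneous_ifs =
  fixes L :: nat and \<rho> :: real and a :: "nat \<Rightarrow> real" and K :: "real set"
  assumes two_le_L: "L \<ge> 2" and rho_pos: "0 < \<rho>" and rho_less_1: "\<rho> < 1"
    and translation_bounds: "\<And>j. j \<in> {1..L} \<Longrightarrow> 0 \<le> a j \<and> a j \<le> 1 - \<rho>"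
    and attractor: "is_attractor L (ifs_map \<rho> a) K"
    and separation: "strong_separation L (ifs_map \<rho> a) K"
begin

abbreviation \<phi> :: "nat \<Rightarrow> real \<Rightarrow> real" where "\<phi> \<equiv> ifs_map \<rho> a"
abbreviation T :: "real \<Rightarrow> real" where "T \<equiv> shift_map L \<phi>"
abbreviation code :: "real \<Rightarrow> nat \<Rightarrow> nat" where "code \<equiv> coding L \<phi>"

text \<open>The value \<open>\<pi>(\<epsilon>)\<close> in closed form, obtained by expanding the composed affine maps; a series is
  easier to shift and to estimate than a point of a nested intersection.\<close>
definition address_sum :: "(nat \<Rightarrow> nat) \<Rightarrow> real" where
  "address_sum \<epsilon> = (\<Sum>i. \<rho> ^ i * a (\<epsilon> i))"

lemma K_facts: "K \<noteq> {}" "compact K" "closed K" "K \<subseteq> {0..1}"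
  using attractor by (auto simp: is_attractor_def compact_imp_closed)

lemma K_eq: "K = (\<Union>j\<in>{1..L}. \<phi> j ` K)"
  using attractor by (simp add: is_attractor_def)

lemma ifs_map_in_K: "j \<in> {1..L} \<Longrightarrow> x \<in> K \<Longrightarrow> \<phi> j x \<in> K"
  using K_eq by blast

lemma dist_in_K: "x \<in> K \<Longrightarrow> y \<in> K \<Longrightarrow> \<bar>x - y\<bar> \<le> 1"
proof -
  assume "x \<in> K" "y \<in> K"
  then have "x \<in> {0..1}" "y \<in> {0..1}" using K_facts(4) by blast+
  then show ?thesis by (simp add: abs_if)
qed

lemma exists_rho_power_less: "0 < e \<Longrightarrow> \<exists>n. \<rho> ^ n < e"
  using real_arch_pow_inv[of e \<rho>] rho_less_1 by blast

lemma eq_if_close: 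
  assumes "\<And>n. \<bar>x - y\<bar> \<le> \<rho> ^ n" shows "x = y"
proof (rule ccontr)
  assume "x \<noteq> y"
  then have "0 < \<bar>x - y\<bar>" by simp
  then obtain n where "\<rho> ^ n < \<bar>x - y\<bar>" using exists_rho_power_less by blast
  with assms[of n] show False by simp
qed

lemma cylinder_map_eq: "cylinder_map \<phi> \<epsilon> n t = \<rho> ^ n * t + (\<Sum>i<n. \<rho> ^ i * a (\<epsilon> i))"
  by (induction n arbitrary: t) (simp_all add: ifs_map_def algebra_simps)

lemma cylinder_map_in_K: "\<epsilon> \<in> code_space L \<Longrightarrow> x \<in> K \<Longrightarrow> cylinder_map \<phi> \<epsilon> n x \<in> K"
  by (induction n arbitrary: x) (simp_all add: code_space_def ifs_map_in_K)

lemma left_shift_in_code_space: "\<epsilon> \<in> code_space L \<Longrightarrow> left_shift \<epsilon> \<in> code_space L"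
  by (simp add: code_space_def left_shift_def)

lemma code_space_tail: "\<epsilon> \<in> code_space L \<Longrightarrow> (\<lambda>i. \<epsilon> (i + n)) \<in> code_space L"
  by (simp add: code_space_def)

lemma
  assumes "\<epsilon> \<in> code_space L"
  shows address_summable: "summable (\<lambda>i. \<rho> ^ i * a (\<epsilon> i))"
    and address_sum_unit: "address_sum \<epsilon> \<in> {0..1}"
proof -
  have letter: "0 \<le> a (\<epsilon> i)" "a (\<epsilon> i) \<le> 1 - \<rho>" for i
    using assms translation_bounds by (auto simp: code_space_def)
  have geo: "(\<lambda>i. \<rho> ^ i * (1 - \<rho>)) sums 1"
    using sums_mult2[OF geometric_sums[of \<rho>], of "1 - \<rho>"] rho_pos rho_less_1 by simp
  have le: "\<rho> ^ i * a (\<epsilon> i) \<le> \<rho> ^ i * (1 - \<rho>)" for i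
    using letter rho_pos by (intro mult_left_mono) auto
  have nonneg: "0 \<le> \<rho> ^ i * a (\<epsilon> i)" for i
    using letter rho_pos by simp
  show s: "summable (\<lambda>i. \<rho> ^ i * a (\<epsilon> i))"
  proof (rule summable_comparison_test'[OF sums_summable[OF geo], of 0])
    show "norm (\<rho> ^ i * a (\<epsilon> i)) \<le> \<rho> ^ i * (1 - \<rho>)" for i
      using le[of i] nonneg[of i] by (simp only: real_norm_def abs_of_nonneg)
  qed
  have "address_sum \<epsilon> \<le> 1"
    unfolding address_sum_def using suminf_le[OF le s sums_summable[OF geo]] sums_unique[OF geo] by simp
  moreover have "0 \<le> address_sum \<epsilon>"
    unfolding address_sum_def using suminf_nonneg[OF s nonneg] .
  ultimately show "address_sum \<epsilon> \<in> {0..1}" by simp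
qed

lemma address_sum_tail:
  assumes "\<epsilon> \<in> code_space L"
  shows "address_sum \<epsilon> = cylinder_map \<phi> \<epsilon> n (address_sum (\<lambda>i. \<epsilon> (i + n)))"
proof -
  have "(\<Sum>i. \<rho> ^ (i + n) * a (\<epsilon> (i + n))) = (\<Sum>i. \<rho> ^ n * (\<rho> ^ i * a (\<epsilon> (i + n))))"
    by (simp add: power_add mult_ac)
  also have "\<dots> = \<rho> ^ n * address_sum (\<lambda>i. \<epsilon> (i + n))"
    unfolding address_sum_def using address_summable[OF code_space_tail[OF assms]]
    by (rule suminf_mult)
  finally show ?thesis
    unfolding cylinder_map_eq address_sum_def[of \<epsilon>]
    using suminf_split_initial_segment[OF address_summable[OF assms], of n] by simp
qed

lemma cylinder_map_dist:
  "\<bar>cylinder_map \<phi> \<epsilon> n s - cylinder_map \<phi> \<epsilon> n t\<bar> = \<rho> ^ n * \<bar>s - t\<bar>"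
proof -
  have "cylinder_map \<phi> \<epsilon> n s - cylinder_map \<phi> \<epsilon> n t = \<rho> ^ n * (s - t)"
    by (simp add: cylinder_map_eq algebra_simps)
  then show ?thesis using rho_pos by (simp add: abs_mult)
qed

text \<open>The cylinder of order \<open>n\<close> has length \<open>\<rho> ^ n\<close>, so it can contain only one point for all \<open>n\<close>.\<close>
lemma address_sum_unique:
  assumes "\<epsilon> \<in> code_space L" and "\<And>n. \<exists>t\<in>{0..1}. y = cylinder_map \<phi> \<epsilon> (Suc n) t"
  shows "y = address_sum \<epsilon>"
proof (rule eq_if_close)
  fix n
  obtain t where t: "t \<in> {0..1}" "y = cylinder_map \<phi> \<epsilon> (Suc n) t" using assms(2) by blast
  let ?s = "address_sum (\<lambda>i. \<epsilon> (i + Suc n))"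
  have s: "?s \<in> {0..1}" using address_sum_unit code_space_tail[OF assms(1)] by blast
  have "\<bar>y - address_sum \<epsilon>\<bar> = \<rho> ^ Suc n * \<bar>t - ?s\<bar>"
    using t(2) address_sum_tail[OF assms(1), of "Suc n"] cylinder_map_dist by metis
  also have "\<dots> \<le> \<rho> ^ n * 1"
    using t(1) s rho_pos rho_less_1
    by (intro mult_mono) (auto simp: abs_if mult_le_cancel_right1)
  finally show "\<bar>y - address_sum \<epsilon>\<bar> \<le> \<rho> ^ n" by simp
qed

lemma code_point_eq:
  assumes "\<epsilon> \<in> code_space L"
  shows "code_point \<phi> \<epsilon> = address_sum \<epsilon>"
  unfolding code_point_def
proof (rule the_equality)
  show "address_sum \<epsilon> \<in> (\<Inter>n\<in>{1..}. cylinder_map \<phi> \<epsilon> n ` {0..1})"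
    using address_sum_tail[OF assms] address_sum_unit[OF code_space_tail[OF assms]] by blast
  fix y assume "y \<in> (\<Inter>n\<in>{1..}. cylinder_map \<phi> \<epsilon> n ` {0..1})"
  then have "\<And>n. \<exists>t\<in>{0..1}. y = cylinder_map \<phi> \<epsilon> (Suc n) t" by fastforce
  then show "y = address_sum \<epsilon>" by (rule address_sum_unique[OF assms])
qed

lemma address_sum_Cons:
  assumes "\<epsilon> \<in> code_space L"
  shows "address_sum \<epsilon> = \<phi> (\<epsilon> 0) (address_sum (left_shift \<epsilon>))"
  using address_sum_tail[OF assms, of 1] by (simp add: left_shift_def)

text \<open>Following the composed maps from any point of \<open>K\<close> stays in \<open>K\<close> and converges to the address
  sum; \<open>K\<close> is closed.\<close>
lemma address_sum_in_K:
  assumes "\<epsilon> \<in> code_space L"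
  shows "address_sum \<epsilon> \<in> K"
proof -
  obtain k where k: "k \<in> K" using K_facts by blast
  have "(\<lambda>n. \<rho> ^ n * k + (\<Sum>i<n. \<rho> ^ i * a (\<epsilon> i))) \<longlonglongrightarrow> 0 * k + address_sum \<epsilon>"
    unfolding address_sum_def using rho_pos rho_less_1
    by (intro tendsto_add tendsto_mult tendsto_const summable_LIMSEQ address_summable assms
        LIMSEQ_power_zero) auto
  then have "(\<lambda>n. cylinder_map \<phi> \<epsilon> n k) \<longlonglongrightarrow> address_sum \<epsilon>"
    by (simp add: cylinder_map_eq)
  then show ?thesis
    by (rule closed_sequentially[OF K_facts(3) cylinder_map_in_K[OF assms k]])
qed

text \<open>Choosing a preimage of \<open>x\<close> in \<open>K\<close> under one of the maps, then a preimage of that preimage, and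
  so on, records a code of \<open>x\<close>.\<close>
lemma address_exists:
  assumes "x \<in> K"
  shows "\<exists>\<epsilon>\<in>code_space L. address_sum \<epsilon> = x"
proof -
  have "\<forall>x\<in>K. \<exists>j y. j \<in> {1..L} \<and> y \<in> K \<and> x = \<phi> j y"
    using K_eq by blast
  then obtain J Y where JY: "\<And>x. x \<in> K \<Longrightarrow> J x \<in> {1..L} \<and> Y x \<in> K \<and> x = \<phi> (J x) (Y x)"
    by metis
  define \<epsilon> where "\<epsilon> n = J ((Y ^^ n) x)" for n
  have inK: "(Y ^^ n) x \<in> K" for n
    by (induction n) (use assms JY in auto)
  have \<epsilon>: "\<epsilon> \<in> code_space L"
    using JY inK by (auto simp: code_space_def \<epsilon>_def)
  have "x = cylinder_map \<phi> \<epsilon> n ((Y ^^ n) x)" for n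
  proof (induction n)
    case (Suc n)
    have "(Y ^^ n) x = \<phi> (\<epsilon> n) ((Y ^^ Suc n) x)"
      using JY[OF inK[of n]] by (simp add: \<epsilon>_def)
    then have "cylinder_map \<phi> \<epsilon> n ((Y ^^ n) x) = cylinder_map \<phi> \<epsilon> (Suc n) ((Y ^^ Suc n) x)"
      by (simp only: cylinder_map.simps o_apply)
    with Suc show ?case by (rule trans)
  qed simp
  then have "x = address_sum \<epsilon>"
    by (intro address_sum_unique[OF \<epsilon>] bexI[OF _ subsetD[OF K_facts(4) inK]])
  with \<epsilon> show ?thesis by blast
qed

lemma first_letter_unique:
  assumes "i \<in> {1..L}" "j \<in> {1..L}" "x \<in> K" "y \<in> K" "\<phi> i x = \<phi> j y"
  shows "i = j"
  using separation assms unfolding strong_separation_def disjoint_family_on_def by blast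

lemma ifs_map_inj: "\<phi> j x = \<phi> j y \<longleftrightarrow> x = y"
  using rho_pos by (simp add: ifs_map_def)

lemma code_space_letter: "\<epsilon> \<in> code_space L \<Longrightarrow> \<epsilon> n \<in> {1..L}"
  by (simp add: code_space_def)

text \<open>One step of uniqueness of codes: separation of the pieces determines the first letter, and
  injectivity of the maps passes to the tails.\<close>
lemma address_sum_eq_imp:
  assumes "\<epsilon> \<in> code_space L" "\<epsilon>' \<in> code_space L" "address_sum \<epsilon> = address_sum \<epsilon>'"
  shows "\<epsilon> 0 = \<epsilon>' 0 \<and> address_sum (left_shift \<epsilon>) = address_sum (left_shift \<epsilon>')"
proof -
  have eq: "\<phi> (\<epsilon> 0) (address_sum (left_shift \<epsilon>)) = \<phi> (\<epsilon>' 0) (address_sum (left_shift \<epsilon>'))"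
    using address_sum_Cons assms by metis
  then have "\<epsilon> 0 = \<epsilon>' 0"
    by (intro first_letter_unique[OF _ _ _ _ eq] code_space_letter address_sum_in_K
        left_shift_in_code_space assms)
  with eq show ?thesis by (simp add: ifs_map_inj)
qed

lemma address_unique:
  assumes "\<epsilon> \<in> code_space L" "\<epsilon>' \<in> code_space L" "address_sum \<epsilon> = address_sum \<epsilon>'"
  shows "\<epsilon> = \<epsilon>'"
proof
  fix n
  show "\<epsilon> n = \<epsilon>' n" using assms
  proof (induction n arbitrary: \<epsilon> \<epsilon>')
    case 0
    then show ?case using address_sum_eq_imp by blast
  next
    case (Suc n)
    have "left_shift \<epsilon> n = left_shift \<epsilon>' n"
      using Suc.prems address_sum_eq_imp
      by (intro Suc.IH left_shift_in_code_space) blast+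
    then show ?case by (simp add: left_shift_def)
  qed
qed

lemma coding_address_sum:
  assumes "\<epsilon> \<in> code_space L"
  shows "code (address_sum \<epsilon>) = \<epsilon>"
  unfolding coding_def
  by (rule the_equality) (use assms address_unique code_point_eq in auto)

lemma
  assumes "x \<in> K"
  shows coding_in_code_space: "code x \<in> code_space L"
    and address_sum_coding: "address_sum (code x) = x"
proof -
  obtain \<epsilon> where \<epsilon>: "\<epsilon> \<in> code_space L" "address_sum \<epsilon> = x"
    using address_exists[OF assms] by blast
  then show "code x \<in> code_space L" "address_sum (code x) = x"
    using coding_address_sum[of \<epsilon>] by auto
qed

lemma shift_map_eq: "x \<in> K \<Longrightarrow> T x = address_sum (left_shift (code x))"
  by (simp add: shift_map_def code_point_eq coding_in_code_space left_shift_in_code_space)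

lemma shift_map_in_K: "x \<in> K \<Longrightarrow> T x \<in> K"
  by (simp add: shift_map_eq address_sum_in_K coding_in_code_space left_shift_in_code_space)

lemma coding_shift_map: "x \<in> K \<Longrightarrow> code (T x) = left_shift (code x)"
  by (simp add: shift_map_eq coding_address_sum coding_in_code_space left_shift_in_code_space)

lemma ifs_map_shift_map: "x \<in> K \<Longrightarrow> \<phi> (code x 0) (T x) = x"
  using address_sum_Cons[OF coding_in_code_space] address_sum_coding shift_map_eq by metis

lemma coding_ifs_map:
  assumes "x \<in> K" "j \<in> {1..L}"
  shows "code (\<phi> j x) = case_nat j (code x)"
proof -
  have c: "case_nat j (code x) \<in> code_space L"
    using coding_in_code_space[OF assms(1)] assms(2) by (auto simp: code_space_def split: nat.split)
  have "address_sum (case_nat j (code x)) = \<phi> j x"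
    using address_sum_Cons[OF c] address_sum_coding[OF assms(1)] by (simp add: left_shift_def)
  then show ?thesis using coding_address_sum[OF c] by simp
qed

lemma letter_range: "x \<in> K \<Longrightarrow> code x n \<in> {1..L}"
  by (intro code_space_letter coding_in_code_space)

lemma
  assumes "x \<in> K"
  shows funpow_shift_in_K: "(T ^^ n) x \<in> K"
    and coding_funpow_shift: "code ((T ^^ n) x) i = code x (n + i)"
proof -
  have "(T ^^ n) x \<in> K \<and> (\<forall>i. code ((T ^^ n) x) i = code x (n + i))"
    by (induction n) (use assms in \<open>auto simp: shift_map_in_K coding_shift_map left_shift_def\<close>)
  then show "(T ^^ n) x \<in> K" "code ((T ^^ n) x) i = code x (n + i)" by auto
qed

section \<open>Distances and common prefixes of codes\<close>

text \<open>Points of the same first-level piece are moved apart by the factor \<open>1 / \<rho>\<close>; iterating this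
  relates distances to the length of the common prefix in both directions.\<close>
lemma dist_shift_map:
  assumes "x \<in> K" "y \<in> K" "code x 0 = code y 0"
  shows "\<bar>x - y\<bar> = \<rho> * \<bar>T x - T y\<bar>"
proof -
  have "x = \<phi> (code x 0) (T x)" "y = \<phi> (code x 0) (T y)"
    using ifs_map_shift_map assms by metis+
  then have "\<bar>x - y\<bar> = \<bar>\<rho> * (T x - T y)\<bar>"
    using ifs_map_def[of \<rho> a "code x 0" "T x"] ifs_map_def[of \<rho> a "code x 0" "T y"]
    by (simp only: right_diff_distrib)
  then show ?thesis using rho_pos by (simp add: abs_mult)
qed

lemma dist_le_if_codes_agree:
  assumes "x \<in> K" "y \<in> K" "\<And>i. i < n \<Longrightarrow> code x i = code y i"
  shows "\<bar>x - y\<bar> \<le> \<rho> ^ n"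
  using assms
proof (induction n arbitrary: x y)
  case 0
  then show ?case using dist_in_K by simp
next
  case (Suc n)
  have "code (T x) i = code (T y) i" if "i < n" for i
    using Suc.prems that by (simp add: coding_shift_map left_shift_def)
  then have "\<bar>T x - T y\<bar> \<le> \<rho> ^ n"
    using Suc.IH Suc.prems shift_map_in_K by blast
  moreover have "\<bar>x - y\<bar> = \<rho> * \<bar>T x - T y\<bar>"
    using Suc.prems by (intro dist_shift_map) auto
  ultimately show ?case using rho_pos by simp
qed

text \<open>Finitely many disjoint compact pieces have positive mutual distances.\<close>
lemma exists_gap:
  "\<exists>\<delta>>0. \<forall>x\<in>K. \<forall>y\<in>K. \<bar>x - y\<bar> \<le> \<delta> \<longrightarrow> code x 0 = code y 0"
proof -
  have piece: "compact (\<phi> j ` K)" for j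
    unfolding ifs_map_def
    by (intro compact_continuous_image continuous_intros K_facts)
  have "\<exists>d>0. \<forall>x\<in>\<phi> i ` K. \<forall>y\<in>\<phi> j ` K. d < \<bar>x - y\<bar>"
    if "i \<in> {1..L}" "j \<in> {1..L}" "i \<noteq> j" for i j
  proof -
    have "\<phi> i ` K \<inter> \<phi> j ` K = {}"
      using that separation by (auto simp: strong_separation_def disjoint_family_on_def)
    then obtain d where "d > 0" "\<forall>x\<in>\<phi> i ` K. \<forall>y\<in>\<phi> j ` K. d \<le> dist x y"
      using separate_compact_closed[OF piece compact_imp_closed[OF piece]] by blast
    \<comment> \<open>halving turns the weak bound into the strict one, so that non-strict closeness can be tested\<close>
    then have "0 < d / 2" "\<forall>x\<in>\<phi> i ` K. \<forall>y\<in>\<phi> j ` K. d / 2 < \<bar>x - y\<bar>"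
      unfolding dist_real_def by fastforce+
    then show ?thesis by blast
  qed
  then obtain d where d: "\<And>i j. i \<in> {1..L} \<Longrightarrow> j \<in> {1..L} \<Longrightarrow> i \<noteq> j \<Longrightarrow>
      0 < d i j \<and> (\<forall>x\<in>\<phi> i ` K. \<forall>y\<in>\<phi> j ` K. d i j < \<bar>x - y\<bar>)"
    by metis
  define D where "D = insert 1 ((\<lambda>(i, j). d i j) ` {(i, j). i \<in> {1..L} \<and> j \<in> {1..L} \<and> i \<noteq> j})"
  have "finite {(i, j). i \<in> {1..L} \<and> j \<in> {1..L} \<and> i \<noteq> j}"
    by (rule finite_subset[of _ "{1..L} \<times> {1..L}"]) auto
  then have fin: "finite D" "D \<noteq> {}" by (auto simp: D_def)
  have "0 < Min D" using fin d by (auto simp: D_def)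
  moreover have "code x 0 = code y 0" if "x \<in> K" "y \<in> K" "\<bar>x - y\<bar> \<le> Min D" for x y
  proof (rule ccontr)
    assume ne: "code x 0 \<noteq> code y 0"
    have "x \<in> \<phi> (code x 0) ` K" "y \<in> \<phi> (code y 0) ` K"
      using that ifs_map_shift_map shift_map_in_K by (metis image_eqI)+
    then have "d (code x 0) (code y 0) < \<bar>x - y\<bar>"
      using d ne letter_range that by blast
    moreover have "d (code x 0) (code y 0) \<in> D"
      unfolding D_def using ne letter_range that by auto
    ultimately show False using Min_le[OF fin(1)] that(3) by fastforce
  qed
  ultimately show ?thesis by blast
qed

definition gap :: real where
  "gap = (SOME \<delta>. \<delta> > 0 \<and> (\<forall>x\<in>K. \<forall>y\<in>K. \<bar>x - y\<bar> \<le> \<delta> \<longrightarrow> code x 0 = code y 0))"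

lemma gap_pos: "gap > 0"
  and same_first_letter: "x \<in> K \<Longrightarrow> y \<in> K \<Longrightarrow> \<bar>x - y\<bar> \<le> gap \<Longrightarrow> code x 0 = code y 0"
  using someI_ex[OF exists_gap] unfolding gap_def by blast+

lemma codes_agree_if_close:
  assumes "x \<in> K" "y \<in> K" "\<bar>x - y\<bar> \<le> gap * \<rho> ^ n" "i < n"
  shows "code x i = code y i"
  using assms
proof (induction n arbitrary: x y i)
  case (Suc n)
  have "gap * \<rho> ^ Suc n \<le> gap * 1"
    using gap_pos rho_pos rho_less_1 by (intro mult_left_mono power_le_one) auto
  then have 0: "code x 0 = code y 0"
    using Suc.prems(3) by (intro same_first_letter Suc.prems(1,2)) linarith
  have "\<rho> * \<bar>T x - T y\<bar> \<le> \<rho> * (gap * \<rho> ^ n)"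
    using Suc.prems(3) dist_shift_map[OF Suc.prems(1,2) 0] by (simp add: mult_ac)
  then have "\<bar>T x - T y\<bar> \<le> gap * \<rho> ^ n" using rho_pos by simp
  then have "code (T x) i = code (T y) i" if "i < n" for i
    using Suc.IH Suc.prems(1,2) shift_map_in_K that by blast
  then have "code x (Suc i) = code y (Suc i)" if "i < n" for i
    using Suc.prems(1,2) that by (simp add: coding_shift_map left_shift_def)
  with 0 Suc.prems(4) show ?case by (cases i) auto
qed simp

end

section \<open>Independence of the letters\<close>

text \<open>Events are described by predicates on codes rather than by subsets of \<open>K\<close>: composing with the
  shift or prepending a letter is then a substitution, and measurability reduces to depending on
  finitely many letters.\<close>
definition depends_below :: "nat \<Rightarrow> ((nat \<Rightarrow> nat) \<Rightarrow> bool) \<Rightarrow> bool" where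
  "depends_below N Q \<longleftrightarrow> (\<forall>c c'. (\<forall>i<N. c i = c' i) \<longrightarrow> Q c = Q c')"

lemma depends_belowI:
  "(\<And>c c'. (\<And>i. i < N \<Longrightarrow> c i = c' i) \<Longrightarrow> Q c = Q c') \<Longrightarrow> depends_below N Q"
  unfolding depends_below_def by blast

lemma depends_belowD:
  "depends_below N Q \<Longrightarrow> (\<And>i. i < N \<Longrightarrow> c i = c' i) \<Longrightarrow> Q c = Q c'"
  unfolding depends_below_def by blast

lemma depends_below_mono: "depends_below N Q \<Longrightarrow> N \<le> M \<Longrightarrow> depends_below M Q"
  unfolding depends_below_def by (meson less_le_trans)

lemma depends_below_conj:
  "depends_below N P \<Longrightarrow> depends_below N Q \<Longrightarrow> depends_below N (\<lambda>c. P c \<and> Q c)"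
  unfolding depends_below_def by blast

lemma depends_below_not: "depends_below N P \<Longrightarrow> depends_below N (\<lambda>c. \<not> P c)"
  unfolding depends_below_def by blast

lemma depends_below_shift:
  assumes "depends_below M Q"
  shows "depends_below (N + M) (\<lambda>c. Q (\<lambda>i. c (N + i)))"
  by (rule depends_belowI, rule depends_belowD[OF assms]) simp

lemma depends_below_Cons:
  assumes "depends_below (Suc N) Q"
  shows "depends_below N (\<lambda>c. Q (case_nat j c))"
  by (rule depends_belowI, rule depends_belowD[OF assms]) (auto split: nat.split)

text \<open>A return at time \<open>n\<close> to the cylinder of order \<open>l\<close> around the starting point. The two words that
  are compared overlap if \<open>n < l\<close>.\<close>
definition returns :: "nat \<Rightarrow> nat \<Rightarrow> (nat \<Rightarrow> nat) \<Rightarrow> bool" where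
  "returns n l c \<longleftrightarrow> (\<forall>i<l. c (n + i) = c i)"

lemma depends_below_returns: "depends_below (n + l) (returns n l)"
  unfolding returns_def by (rule depends_belowI) auto

context homogeneous_ifs
begin

definition event :: "((nat \<Rightarrow> nat) \<Rightarrow> bool) \<Rightarrow> real set" where
  "event Q = {x \<in> K. Q (code x)}"

text \<open>Conditioning on the first letter, in geometric form.\<close>
lemma event_Cons: "event Q = (\<Union>j\<in>{1..L}. \<phi> j ` event (\<lambda>c. Q (case_nat j c)))"
proof (rule set_eqI)
  fix x
  have "x \<in> event Q \<longleftrightarrow> (\<exists>j\<in>{1..L}. \<exists>y\<in>K. x = \<phi> j y \<and> Q (code x))"
    using K_eq unfolding event_def by blast
  also have "\<dots> \<longleftrightarrow> (\<exists>j\<in>{1..L}. \<exists>y\<in>K. x = \<phi> j y \<and> Q (case_nat j (code y)))"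
    using coding_ifs_map by metis
  also have "\<dots> \<longleftrightarrow> x \<in> (\<Union>j\<in>{1..L}. \<phi> j ` event (\<lambda>c. Q (case_nat j c)))"
    unfolding event_def by blast
  finally show "x \<in> event Q \<longleftrightarrow> x \<in> (\<Union>j\<in>{1..L}. \<phi> j ` event (\<lambda>c. Q (case_nat j c)))" .
qed

text \<open>By induction on the number of letters, the event is a finite union of affine copies of \<open>K\<close>. This
  is what makes it measurable.\<close>
lemma compact_event: "depends_below N Q \<Longrightarrow> compact (event Q)"
proof (induction N arbitrary: Q)
  case 0
  have "Q c = Q c'" for c c' using depends_belowD[OF 0] by blast
  then have "event Q = K \<or> event Q = {}" unfolding event_def by blast
  then show ?case using K_facts(2) by auto
next
  case (Suc N)
  have "compact (\<phi> j ` event (\<lambda>c. Q (case_nat j c)))" for j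
    unfolding ifs_map_def
    by (intro compact_continuous_image continuous_intros Suc.IH[unfolded ifs_map_def] depends_below_Cons Suc.prems)
  then show ?case
    by (subst event_Cons) (intro compact_UN, simp_all)
qed

end

locale self_similar_measure = homogeneous_ifs +
  fixes \<mu> :: "real measure"
  assumes natural: "is_natural_measure L (ifs_map \<rho> a) K \<mu>"
begin

sublocale prob_space \<mu>
  using natural by (simp add: is_natural_measure_def)

lemma sets_mu: "sets \<mu> = sets borel" and measure_K: "prob K = 1"
  using natural by (simp_all add: is_natural_measure_def)

lemma measure_self_similar:
  "A \<in> sets borel \<Longrightarrow> prob A = (1 / real L) * (\<Sum>j=1..L. prob (\<phi> j -` A \<inter> {0..1}))"
  using natural by (simp add: is_natural_measure_def)

lemma K_sets: "K \<in> sets \<mu>"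
  using K_facts(3) by (simp add: sets_mu)

lemma AE_in_K: "AE x in \<mu>. x \<in> K"
  using prob_eq_1[OF K_sets] measure_K by simp

lemma event_sets: "depends_below N Q \<Longrightarrow> event Q \<in> sets \<mu>"
  using compact_event by (simp add: sets_mu borel_compact)

abbreviation code_prob :: "((nat \<Rightarrow> nat) \<Rightarrow> bool) \<Rightarrow> real" where
  "code_prob Q \<equiv> prob (event Q)"

lemma code_prob_const: "code_prob (\<lambda>c. b) = (if b then 1 else 0)"
  using measure_K by (simp add: event_def)

text \<open>Self-similarity of \<open>\<mu>\<close> on the level of codes. The preimage under \<open>\<phi> j\<close> may contain points of
  \<open>[0, 1]\<close> outside \<open>K\<close>, which is why the comparison is made almost everywhere.\<close>
lemma code_prob_Cons:
  assumes "depends_below (Suc N) Q"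
  shows "code_prob Q = (1 / real L) * (\<Sum>j=1..L. code_prob (\<lambda>c. Q (case_nat j c)))"
proof -
  have ev: "event Q \<in> sets borel" using event_sets[OF assms] by (simp add: sets_mu)
  have "prob (\<phi> j -` event Q \<inter> {0..1}) = code_prob (\<lambda>c. Q (case_nat j c))" if j: "j \<in> {1..L}" for j
  proof (rule finite_measure_eq_AE)
    show "event (\<lambda>c. Q (case_nat j c)) \<in> sets \<mu>"
      by (rule event_sets[OF depends_below_Cons[OF assms]])
    have "\<phi> j \<in> borel_measurable borel"
      unfolding ifs_map_def by measurable
    from measurable_sets[OF this ev] show "\<phi> j -` event Q \<inter> {0..1} \<in> sets \<mu>"
      by (simp add: sets_mu)
    show "AE x in \<mu>. x \<in> \<phi> j -` event Q \<inter> {0..1} \<longleftrightarrow> x \<in> event (\<lambda>c. Q (case_nat j c))"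
      using AE_in_K
    proof eventually_elim
      case (elim x)
      then have "x \<in> {0..1}" using K_facts(4) by blast
      then show ?case
        using elim coding_ifs_map[OF elim j] ifs_map_in_K[OF j elim] by (simp add: event_def)
    qed
  qed
  then show ?thesis using measure_self_similar[OF ev] by simp
qed

text \<open>The Bernoulli property: a shifted event is independent of the letters that were shifted away.
  Induction on \<open>N\<close>: both sides are averaged in the same way over the first letter.\<close>
lemma code_prob_independent:
  assumes "depends_below N P" "depends_below M Q"
  shows "code_prob (\<lambda>c. P c \<and> Q (\<lambda>i. c (N + i))) = code_prob P * code_prob Q"
  using assms(1)
proof (induction N arbitrary: P)
  case 0
  have "P c = P (\<lambda>_. 0)" for c using depends_belowD[OF 0] by blast
  then have P: "P = (\<lambda>c. P (\<lambda>_. 0))" by blast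
  show ?case
    by (subst (1 2) P) (cases "P (\<lambda>_. 0)"; simp add: code_prob_const)
next
  case (Suc N)
  have "depends_below (Suc N + M) (\<lambda>c. P c \<and> Q (\<lambda>i. c (Suc N + i)))"
    by (intro depends_below_conj depends_below_mono[OF Suc.prems] depends_below_shift[OF assms(2)]) simp
  then have "depends_below (Suc (N + M)) (\<lambda>c. P c \<and> Q (\<lambda>i. c (Suc N + i)))"
    by simp
  from code_prob_Cons[OF this]
  have "code_prob (\<lambda>c. P c \<and> Q (\<lambda>i. c (Suc N + i))) =
      (1 / real L) * (\<Sum>j=1..L. code_prob (\<lambda>c. P (case_nat j c) \<and> Q (\<lambda>i. c (N + i))))"
    by simp
  also have "\<dots> = (1 / real L) * (\<Sum>j=1..L. code_prob (\<lambda>c. P (case_nat j c)) * code_prob Q)"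
    using Suc.IH[OF depends_below_Cons[OF Suc.prems]] by simp
  also have "\<dots> = code_prob P * code_prob Q"
    unfolding code_prob_Cons[OF Suc.prems] by (simp add: sum_distrib_right)
  finally show ?case .
qed

lemma code_prob_letter:
  assumes "j \<in> {1..L}"
  shows "code_prob (\<lambda>c. c 0 = j) = 1 / real L"
proof -
  have "depends_below (Suc 0) (\<lambda>c. c 0 = j)" by (simp add: depends_below_def)
  from code_prob_Cons[OF this] show ?thesis
    using assms by (simp add: code_prob_const)
qed

lemma code_prob_letter_after:
  assumes "depends_below n P" "j \<in> {1..L}"
  shows "code_prob (\<lambda>c. P c \<and> c n = j) = code_prob P / real L"
proof -
  have "depends_below 1 (\<lambda>c. c 0 = j)" by (simp add: depends_below_def)
  from code_prob_independent[OF assms(1) this] show ?thesis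
    using code_prob_letter[OF assms(2)] by simp
qed

lemma code_prob_cylinder:
  assumes "w \<in> code_space L"
  shows "code_prob (\<lambda>c. \<forall>i<n. c i = w i) = 1 / real L ^ n"
proof (induction n)
  case 0
  show ?case by (simp add: code_prob_const)
next
  case (Suc n)
  have "depends_below n (\<lambda>c. \<forall>i<n. c i = w i)" by (simp add: depends_below_def)
  from code_prob_letter_after[OF this code_space_letter[OF assms, of n]]
  show ?case using Suc by (simp add: All_less_Suc conj_commute mult.commute)
qed

lemma code_prob_split_letter:
  assumes "depends_below N P"
  shows "code_prob P = (\<Sum>j=1..L. code_prob (\<lambda>c. P c \<and> c l = j))"
proof -
  have "event P = (\<Union>j\<in>{1..L}. event (\<lambda>c. P c \<and> c l = j))"
    unfolding event_def using letter_range by blast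
  also have "prob \<dots> = (\<Sum>j=1..L. code_prob (\<lambda>c. P c \<and> c l = j))"
  proof (rule finite_measure_finite_Union)
    have "event (\<lambda>c. P c \<and> c l = j) \<in> sets \<mu>" for j
    proof (rule event_sets)
      show "depends_below (N + Suc l) (\<lambda>c. P c \<and> c l = j)"
        by (intro depends_below_conj depends_below_mono[OF assms]) (simp_all add: depends_below_def)
    qed
    then show "(\<lambda>j. event (\<lambda>c. P c \<and> c l = j)) ` {1..L} \<subseteq> sets \<mu>" by blast
    show "disjoint_family_on (\<lambda>j. event (\<lambda>c. P c \<and> c l = j)) {1..L}"
      unfolding disjoint_family_on_def event_def by blast
  qed simp
  finally show ?thesis .
qed

text \<open>Enlarging \<open>l\<close> by one compares the letter at \<open>l\<close> with the one at \<open>n + l\<close>. Since \<open>n > 0\<close>,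
  everything known so far, including the value \<open>j\<close> of the letter at \<open>l\<close>, depends on the letters below
  \<open>n + l\<close>, so the next letter equals \<open>j\<close> with probability \<open>1 / L\<close>. Fixing \<open>j\<close> turns the comparison of
  two letters into a condition on one of them.\<close>
lemma code_prob_returns:
  assumes "depends_below n P" "0 < n"
  shows "code_prob (\<lambda>c. P c \<and> returns n l c) = code_prob P / real L ^ l"
proof (induction l)
  case 0
  show ?case by (simp add: returns_def)
next
  case (Suc l)
  define E where "E = (\<lambda>c. P c \<and> returns n l c)"
  have E: "depends_below (n + l) E"
    unfolding E_def
    by (intro depends_below_conj depends_below_mono[OF assms(1)] depends_below_returns) simp
  have l: "depends_below (n + l) (\<lambda>c. c l = j)" for j
    using assms(2) by (simp add: depends_below_def)
  have "code_prob (\<lambda>c. P c \<and> returns n (Suc l) c) = code_prob (\<lambda>c. E c \<and> c (n + l) = c l)"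
    by (intro arg_cong[where f = code_prob] ext) (auto simp: E_def returns_def less_Suc_eq)
  also have "\<dots> = (\<Sum>j=1..L. code_prob (\<lambda>c. (E c \<and> c (n + l) = c l) \<and> c l = j))"
  proof (rule code_prob_split_letter)
    show "depends_below (n + Suc l) (\<lambda>c. E c \<and> c (n + l) = c l)"
      by (intro depends_below_conj depends_below_mono[OF E]) (auto simp: depends_below_def)
  qed
  also have "\<dots> = (\<Sum>j=1..L. code_prob (\<lambda>c. (E c \<and> c l = j) \<and> c (n + l) = j))"
    by (intro sum.cong refl arg_cong[where f = code_prob] ext) auto
  also have "\<dots> = (\<Sum>j=1..L. code_prob (\<lambda>c. E c \<and> c l = j) / real L)"
    by (intro sum.cong refl code_prob_letter_after depends_below_conj E l)
  also have "\<dots> = code_prob E / real L"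
    unfolding code_prob_split_letter[OF E, of l] by (simp add: sum_divide_distrib)
  finally show ?case using Suc by (simp add: E_def mult.commute)
qed

text \<open>When block \<open>j\<close> ends before block \<open>j + 1\<close> starts, the outcome of the earlier blocks depends only on
  letters before the next block, and the probabilities multiply.\<close>
lemma code_prob_no_return:
  assumes start: "\<And>j. 0 < p j" and disjoint: "\<And>j. p j + l j \<le> p (Suc j)"
  shows "depends_below (p J) (\<lambda>c. \<forall>j<J. \<not> returns (p j) (l j) c)" (is "depends_below _ (?E J)")
    and "code_prob (\<lambda>c. \<forall>j<J. \<not> returns (p j) (l j) c) = (\<Prod>j<J. 1 - 1 / real L ^ l j)"
proof -
  show dep: "depends_below (p J) (?E J)" for J
  proof (induction J)
    case (Suc J)
    have "depends_below (p (Suc J)) (\<lambda>c. ?E J c \<and> \<not> returns (p J) (l J) c)"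
      using disjoint[of J]
      by (intro depends_below_conj depends_below_not depends_below_mono[OF Suc]
          depends_below_mono[OF depends_below_returns]) auto
    then show ?case by (simp add: All_less_Suc conj_commute)
  qed (simp add: depends_below_def)
  show "code_prob (?E J) = (\<Prod>j<J. 1 - 1 / real L ^ l j)"
  proof (induction J)
    case 0
    show ?case by (simp add: code_prob_const)
  next
    case (Suc J)
    have R: "depends_below (p J + l J) (\<lambda>c. ?E J c \<and> returns (p J) (l J) c)"
      by (intro depends_below_conj depends_below_mono[OF dep] depends_below_returns) simp
    have "event (?E (Suc J)) = event (?E J) - event (\<lambda>c. ?E J c \<and> returns (p J) (l J) c)"
      unfolding event_def by (auto simp: less_Suc_eq)
    moreover have "event (\<lambda>c. ?E J c \<and> returns (p J) (l J) c) \<subseteq> event (?E J)"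
      unfolding event_def by blast
    ultimately have "code_prob (?E (Suc J)) =
        code_prob (?E J) - code_prob (\<lambda>c. ?E J c \<and> returns (p J) (l J) c)"
      using finite_measure_Diff event_sets[OF dep] event_sets[OF R] by simp
    then show ?case
      using Suc code_prob_returns[OF dep[of J] start, of "l J"] by (simp add: right_diff_distrib)
  qed
qed

text \<open>The divergent half of the Borel--Cantelli lemma for these events: by \<open>1 - t \<le> exp (- t)\<close> the
  product of the probabilities of no return tends to zero.\<close>
lemma AE_some_return:
  assumes start: "\<And>j. 0 < p j" and disjoint: "\<And>j. p j + l j \<le> p (Suc j)"
    and diverges: "filterlim (\<lambda>J. \<Sum>j<J. 1 / real L ^ l j) at_top sequentially"
  shows "AE x in \<mu>. x \<in> K \<longrightarrow> (\<exists>j. returns (p j) (l j) (code x))"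
proof -
  define E where "E J = event (\<lambda>c. \<forall>j<J. \<not> returns (p j) (l j) c)" for J
  have E: "E J \<in> sets \<mu>" for J
    unfolding E_def by (rule event_sets[OF code_prob_no_return(1)[of p l, OF start disjoint]])
  have bound: "prob (\<Inter>J. E J) \<le> exp (- (\<Sum>j<J. 1 / real L ^ l j))" for J
  proof -
    have "prob (\<Inter>J. E J) \<le> prob (E J)"
      using E by (intro finite_measure_mono) auto
    also have "\<dots> = (\<Prod>j<J. 1 - 1 / real L ^ l j)"
      unfolding E_def by (rule code_prob_no_return(2)[of p l, OF start disjoint])
    also have "\<dots> \<le> (\<Prod>j<J. exp (- (1 / real L ^ l j)))"
    proof (intro prod_mono conjI)
      fix j
      have "1 / real L ^ l j \<le> 1" using two_le_L by (simp add: one_le_power)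
      then show "0 \<le> 1 - 1 / real L ^ l j" by simp
      show "1 - 1 / real L ^ l j \<le> exp (- (1 / real L ^ l j))"
        using exp_ge_add_one_self[of "- (1 / real L ^ l j)"] by simp
    qed
    also have "\<dots> = exp (- (\<Sum>j<J. 1 / real L ^ l j))"
      by (simp only: exp_sum[OF finite_lessThan] sum_negf[symmetric])
    finally show ?thesis .
  qed
  have "((\<lambda>J. exp (- (\<Sum>j<J. 1 / real L ^ l j))) \<longlonglongrightarrow> 0)"
    using filterlim_compose[OF exp_at_bot, OF filterlim_uminus_at_bot_at_top[THEN filterlim_compose, OF diverges]] .
  then have "prob (\<Inter>J. E J) \<le> 0"
    using bound by (intro LIMSEQ_le_const) auto
  then have "prob (\<Inter>J. E J) = 0"
    using measure_nonneg[of \<mu> "\<Inter>J. E J"] by linarith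
  moreover have "(\<Inter>J. E J) \<in> sets \<mu>" using E by blast
  ultimately have "AE x in \<mu>. x \<notin> (\<Inter>J. E J)"
    using prob_eq_0 by simp
  then show ?thesis
    by eventually_elim (auto simp: E_def event_def)
qed

end


context homogeneous_ifs
begin

section \<open>Returns are rare above the critical rate\<close>

definition similarity_dim :: real where
  "similarity_dim = ln (real L) / (- ln \<rho>)"

lemma ln_rho_neg: "ln \<rho> < 0" and ln_L_pos: "0 < ln (real L)"
  using rho_pos rho_less_1 two_le_L by auto

lemma similarity_dim_pos: "0 < similarity_dim"
  unfolding similarity_dim_def using ln_rho_neg ln_L_pos by (intro divide_pos_pos) auto

text \<open>The conversion between the size \<open>\<rho> ^ t\<close> and the measure \<open>L ^ (-t)\<close> of a cylinder.\<close>
lemma rho_powr_dim: "\<rho> powr (similarity_dim * t) = real L powr (- t)"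
  using rho_pos ln_rho_neg two_le_L by (simp add: powr_def similarity_dim_def)

text \<open>The cylinder order \<open>m\<close> adapted to a distance \<open>d\<close>: points at distance at most \<open>d\<close> share \<open>m\<close> letters, while
  a cylinder of order \<open>m\<close> has measure at most a constant times \<open>d powr \<gamma>\<close>. For \<open>d > gap\<close> one gets
  \<open>m = 0\<close>, where both claims are trivial.\<close>
lemma exists_scale:
  assumes "0 < d"
  shows "\<exists>m. (\<forall>x\<in>K. \<forall>y\<in>K. \<bar>x - y\<bar> \<le> d \<longrightarrow> (\<forall>i<m. code x i = code y i)) \<and>
    1 / real L ^ m \<le> real L * (d / gap) powr similarity_dim"
proof -
  define t where "t = ln (d / gap) / ln \<rho>"
  have dgap: "0 < d / gap" using assms gap_pos by simp
  have t: "\<rho> powr t = d / gap"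
    using rho_pos ln_rho_neg dgap by (simp add: powr_def t_def)
  define m where "m = nat \<lfloor>t\<rfloor>"
  have "t - 1 \<le> real m" unfolding m_def by linarith
  have "1 / real L ^ m = real L powr (- real m)"
    using two_le_L by (simp add: powr_minus powr_realpow divide_inverse)
  also have "\<dots> \<le> real L powr (1 - t)"
    using two_le_L \<open>t - 1 \<le> real m\<close> by (intro powr_mono) auto
  also have "\<dots> = real L * real L powr (- t)"
    using two_le_L by (simp add: powr_diff powr_minus divide_inverse)
  also have "real L powr (- t) = (\<rho> powr t) powr similarity_dim"
    using rho_powr_dim[of t] by (simp add: powr_powr mult.commute)
  finally have meas: "1 / real L ^ m \<le> real L * (d / gap) powr similarity_dim"
    by (simp add: t)
  have "code x i = code y i" if xy: "x \<in> K" "y \<in> K" "\<bar>x - y\<bar> \<le> d" "i < m" for x y i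
  proof -
    have "real m \<le> t" using \<open>i < m\<close> unfolding m_def by linarith
    then have "\<rho> powr t \<le> \<rho> powr real m"
      using rho_pos rho_less_1 by (intro powr_mono') auto
    then have "d / gap \<le> \<rho> ^ m" using t rho_pos by (simp add: powr_realpow)
    then have "d \<le> gap * \<rho> ^ m" using gap_pos by (simp add: divide_le_eq mult.commute)
    then show ?thesis using codes_agree_if_close[of x y m i] xy by simp
  qed
  with meas show ?thesis by blast
qed

end

context self_similar_measure
begin

text \<open>Coming back within \<open>d n\<close> at time \<open>n\<close> forces a return of the length adapted to \<open>d n\<close>, whose
  probability is of order \<open>d n powr \<gamma>\<close>, that is \<open>n powr (- \<gamma> / \<alpha>)\<close>; the exponent is below \<open>-1\<close>.\<close>
lemma AE_returns_eventually_far: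
  assumes alpha: "0 < \<alpha>" "\<alpha> < similarity_dim" and "0 < C"
  shows "AE x in \<mu>. x \<in> K \<longrightarrow>
    eventually (\<lambda>n. C < real n powr (1 / \<alpha>) * \<bar>(T ^^ n) x - x\<bar>) sequentially"
proof -
  define d where "d n = C * real n powr (- (1 / \<alpha>))" for n
  have d: "0 < d n" if "0 < n" for n using that \<open>0 < C\<close> by (simp add: d_def)
  have "\<exists>m. 0 < n \<longrightarrow> (\<forall>x\<in>K. \<forall>y\<in>K. \<bar>x - y\<bar> \<le> d n \<longrightarrow> (\<forall>i<m. code x i = code y i)) \<and>
      1 / real L ^ m \<le> real L * (d n / gap) powr similarity_dim" for n
    using exists_scale[OF d] by blast
  then obtain m where m: "\<And>n. 0 < n \<Longrightarrow> (\<forall>x\<in>K. \<forall>y\<in>K. \<bar>x - y\<bar> \<le> d n \<longrightarrow> (\<forall>i<m n. code x i = code y i)) \<and>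
      1 / real L ^ m n \<le> real L * (d n / gap) powr similarity_dim"
    by metis
  define A where "A n = (if n = 0 then {} else event (returns n (m n)))" for n
  have A_sets: "A n \<in> sets \<mu>" for n
    unfolding A_def using event_sets[OF depends_below_returns] by simp
  have A_le: "prob (A n) \<le> real L * (C / gap) powr similarity_dim * real n powr (- (similarity_dim / \<alpha>))" for n
  proof (cases "n = 0")
    case False
    have "depends_below n (\<lambda>c. True)" by (simp add: depends_below_def)
    from code_prob_returns[OF this, of "m n"]
    have "prob (A n) = 1 / real L ^ m n"
      using False by (simp add: A_def code_prob_const)
    also have "\<dots> \<le> real L * (d n / gap) powr similarity_dim"
      using m False by simp
    also have "d n / gap = (C / gap) * real n powr (- (1 / \<alpha>))"
      by (simp add: d_def)
    also have "\<dots> powr similarity_dim = (C / gap) powr similarity_dim * (real n powr (- (1 / \<alpha>))) powr similarity_dim"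
      by (rule powr_mult)
    finally show ?thesis
      by (simp add: powr_powr mult.assoc)
  qed (simp add: A_def)
  have "summable (\<lambda>n. real n powr (- (similarity_dim / \<alpha>)))"
    using alpha by (subst summable_real_powr_iff) simp
  then have "summable (\<lambda>n. real L * (C / gap) powr similarity_dim * real n powr (- (similarity_dim / \<alpha>)))"
    by (rule summable_mult)
  then have "summable (\<lambda>n. prob (A n))"
    by (rule summable_comparison_test'[where N = 0]) (use A_le in simp)
  then have "AE x in \<mu>. eventually (\<lambda>n. x \<in> space \<mu> - A n) sequentially"
    by (intro borel_cantelli_AE1 A_sets) (simp_all add: emeasure_eq_measure)
  then show ?thesis
  proof eventually_elim
    case (elim x)
    show ?case
    proof
      assume x: "x \<in> K"
      show "eventually (\<lambda>n. C < real n powr (1 / \<alpha>) * \<bar>(T ^^ n) x - x\<bar>) sequentially"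
        using elim eventually_gt_at_top[of 0]
      proof eventually_elim
        case (elim n)
        have "\<not> returns n (m n) (code x)"
          using elim x by (simp add: A_def event_def)
        then have "\<not> (\<forall>i<m n. code ((T ^^ n) x) i = code x i)"
          unfolding returns_def coding_funpow_shift[OF x] .
        then have "d n < \<bar>(T ^^ n) x - x\<bar>"
          using m[OF elim(2)] funpow_shift_in_K[OF x] x by (meson not_le)
        then have "real n powr (1 / \<alpha>) * d n < real n powr (1 / \<alpha>) * \<bar>(T ^^ n) x - x\<bar>"
          using elim(2) by (intro mult_strict_left_mono) auto
        moreover have "real n powr (1 / \<alpha>) * d n = C"
          using elim(2) by (simp add: d_def powr_minus field_simps)
        ultimately show ?case by simp
      qed
    qed
  qed
qed

end

context homogeneous_ifs
begin

section \<open>Returns at the critical rate\<close>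

text \<open>A return of this length at time \<open>n\<close> has probability about \<open>L ^ (-k) / n\<close> and brings the orbit
  within about \<open>\<rho> ^ k * n powr (- 1 / \<gamma>)\<close>.\<close>
definition block_length :: "nat \<Rightarrow> nat \<Rightarrow> nat" where
  "block_length k n = nat \<lfloor>real k + log L n\<rfloor>"

text \<open>Consecutive blocks, each as long as its own starting position requires.\<close>
primrec block_start :: "nat \<Rightarrow> nat \<Rightarrow> nat \<Rightarrow> nat" where
  "block_start k N 0 = N"
| "block_start k N (Suc j) = block_start k N j + block_length k (block_start k N j)"

lemma log_L_nonneg: "1 \<le> n \<Longrightarrow> 0 \<le> log L (real n)"
  using two_le_L by simp

lemma block_length_bounds:
  assumes "1 \<le> n"
  shows "k \<le> block_length k n" "real (block_length k n) \<le> real k + log L n"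
    "real k + log L n - 1 \<le> real (block_length k n)"
proof -
  have "0 \<le> log L n" using log_L_nonneg[OF assms] .
  then show "k \<le> block_length k n" "real (block_length k n) \<le> real k + log L n"
    "real k + log L n - 1 \<le> real (block_length k n)"
    unfolding block_length_def by linarith+
qed

lemma block_start_ge:
  assumes "1 \<le> k" "1 \<le> N"
  shows "N + j \<le> block_start k N j"
proof (induction j)
  case (Suc j)
  have "k \<le> block_length k (block_start k N j)"
    using Suc assms by (intro block_length_bounds) simp
  then show ?case using Suc assms by simp
qed simp

lemma ln_add_eq: "0 < x \<Longrightarrow> 0 \<le> y \<Longrightarrow> ln (x + y) = ln x + ln (1 + y / x)" for x y :: real
  using ln_mult_pos[of x "1 + y / x"] by (simp add: distrib_left add_pos_nonneg)

text \<open>The derivative of \<open>ln (k + log L n)\<close> in \<open>n\<close> is \<open>1 / (n * ln L * (k + log L n))\<close>, and a block is at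
  most \<open>k + log L n\<close> long, so the length of the block cancels in the increment over it.\<close>
lemma log_increment:
  assumes "1 \<le> k" "1 \<le> n"
  shows "ln (real k + log L (n + block_length k n)) - ln (real k + log L n) \<le> 1 / (real n * ln L)"
proof -
  define u where "u = real k + log L n"
  define l where "l = real (block_length k n)"
  have u: "1 \<le> u" using log_L_nonneg[OF assms(2)] assms(1) by (simp add: u_def)
  have l: "0 \<le> l" "l \<le> u" using block_length_bounds(2)[OF assms(2), of k] by (auto simp: l_def u_def)
  have n: "0 < real n" using assms by simp
  define \<Delta> where "\<Delta> = ln (1 + l / n) / ln L"
  have "ln (real n + l) = ln n + ln (1 + l / n)"
    by (rule ln_add_eq[OF n l(1)])
  then have shift: "log L (n + block_length k n) = log L n + \<Delta>"
    by (simp add: log_def l_def \<Delta>_def add_divide_distrib)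
  have \<Delta>: "0 \<le> \<Delta>" "\<Delta> \<le> l / n / ln L"
    unfolding \<Delta>_def using l n ln_L_pos two_le_L
    by (intro divide_nonneg_pos ln_ge_zero divide_right_mono ln_add_one_self_le_self; auto)+
  have "ln (u + \<Delta>) - ln u = ln (1 + \<Delta> / u)"
    using ln_add_eq[of u \<Delta>] u \<Delta>(1) by simp
  also have "\<dots> \<le> \<Delta> / u"
    using u \<Delta> by (intro ln_add_one_self_le_self) simp
  also have "\<dots> \<le> (u / n / ln L) / u"
    using u \<Delta> l n ln_L_pos
    by (intro divide_right_mono order.trans[OF \<Delta>(2)]) auto
  also have "\<dots> = 1 / (real n * ln L)" using u by simp
  finally show ?thesis unfolding shift by (simp add: u_def add.assoc)
qed

text \<open>Each summand is at least \<open>L ^ (-k) / n\<close> for the starting position \<open>n\<close> of its block. By the previous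
  estimate this dominates a constant times the increment of \<open>ln (k + log L n)\<close>; the increments
  telescope to something unbounded.\<close>
lemma block_sum_diverges:
  assumes "1 \<le> k" "1 \<le> N"
  shows "filterlim (\<lambda>J. \<Sum>j<J. 1 / real L ^ block_length k (block_start k N j)) at_top sequentially"
proof -
  let ?p = "block_start k N"
  define f where "f n = ln (real k + log L (real n))" for n :: nat
  define c where "c = ln L / real L ^ k"
  have c: "0 < c" using ln_L_pos two_le_L by (simp add: c_def)
  have p: "1 \<le> ?p j" for j using block_start_ge[OF assms, of j] assms by simp
  have summand: "c * (f (?p (Suc j)) - f (?p j)) \<le> 1 / real L ^ block_length k (?p j)" for j
  proof -
    have "real L ^ block_length k (?p j) = real L powr real (block_length k (?p j))"
      using two_le_L by (simp add: powr_realpow)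
    also have "\<dots> \<le> real L powr (real k + log L (?p j))"
      using block_length_bounds(2)[OF p] two_le_L by (intro powr_mono) auto
    also have "\<dots> = real L ^ k * real (?p j)"
      using two_le_L p[of j] by (simp add: powr_add powr_realpow)
    finally have "1 / (real L ^ k * real (?p j)) \<le> 1 / real L ^ block_length k (?p j)"
      using two_le_L p[of j] by (intro divide_left_mono mult_pos_pos) auto
    moreover have "c * (f (?p (Suc j)) - f (?p j)) \<le> c * (1 / (real (?p j) * ln L))"
      using log_increment[OF assms(1) p] c unfolding f_def by (intro mult_left_mono) auto
    moreover have "c * (1 / (real (?p j) * ln L)) = 1 / (real L ^ k * real (?p j))"
      using ln_L_pos by (simp add: c_def)
    ultimately show ?thesis by linarith
  qed
  have sum_ge: "c * (f (?p J) - f N) \<le> (\<Sum>j<J. 1 / real L ^ block_length k (?p j))" for J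
  proof -
    have "c * (f (?p J) - f N) = (\<Sum>j<J. c * (f (?p (Suc j)) - f (?p j)))"
      using sum_lessThan_telescope[of "\<lambda>j. f (?p j)" J] by (simp add: sum_distrib_left[symmetric])
    also have "\<dots> \<le> (\<Sum>j<J. 1 / real L ^ block_length k (?p j))"
      by (intro sum_mono summand)
    finally show ?thesis .
  qed
  have "filterlim ?p at_top sequentially"
  proof (rule filterlim_at_top_mono[OF filterlim_ident])
    show "eventually (\<lambda>j. j \<le> ?p j) sequentially"
      by (intro always_eventually allI add_leD2[OF block_start_ge[OF assms]])
  qed
  moreover have "filterlim f at_top sequentially"
    unfolding f_def log_def using ln_L_pos by real_asymp
  ultimately have "filterlim (\<lambda>J. f (?p J)) at_top sequentially"
    by (rule filterlim_compose[rotated])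
  then have "filterlim (\<lambda>J. c * (- f N + f (?p J))) at_top sequentially"
    by (intro filterlim_tendsto_pos_mult_at_top[OF tendsto_const c] filterlim_tendsto_add_at_top[OF tendsto_const])
  then show ?thesis
    by (rule filterlim_at_top_mono) (use sum_ge in \<open>auto simp: algebra_simps\<close>)
qed

lemma return_distance:
  assumes "x \<in> K" "1 \<le> k" "1 \<le> n" "returns n (block_length k n) (code x)"
  shows "real n powr (1 / similarity_dim) * \<bar>(T ^^ n) x - x\<bar> \<le> \<rho> ^ (k - 1)"
proof -
  let ?l = "block_length k n"
  have "\<bar>(T ^^ n) x - x\<bar> \<le> \<rho> ^ ?l"
    using assms(4) coding_funpow_shift[OF assms(1)]
    by (intro dist_le_if_codes_agree funpow_shift_in_K assms(1)) (simp add: returns_def)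
  also have "\<dots> = \<rho> powr real ?l" using rho_pos by (simp add: powr_realpow)
  also have "\<dots> \<le> \<rho> powr (real (k - 1) + log L n)"
    using block_length_bounds(3)[OF assms(3), of k] assms(2) rho_pos rho_less_1
    by (intro powr_mono') auto
  also have "\<dots> = \<rho> ^ (k - 1) * \<rho> powr log L n"
    using rho_pos by (simp add: powr_add powr_realpow)
  also have "\<rho> powr log L n = real n powr (- (1 / similarity_dim))"
    using ln_L_pos ln_rho_neg assms(3) rho_pos by (simp add: powr_def log_def similarity_dim_def)
  finally have "real n powr (1 / similarity_dim) * \<bar>(T ^^ n) x - x\<bar> \<le>
      real n powr (1 / similarity_dim) * (\<rho> ^ (k - 1) * real n powr (- (1 / similarity_dim)))"
    by (intro mult_left_mono) auto
  also have "\<dots> = \<rho> ^ (k - 1)" using assms(3) by (simp add: powr_minus)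
  finally show ?thesis .
qed

end

context self_similar_measure
begin

text \<open>Starting the blocks beyond \<open>N\<close> gives returns at arbitrarily late times, and enlarging \<open>k\<close> makes
  them arbitrarily close. A larger \<open>\<alpha>\<close> only decreases the factor \<open>n powr (1 / \<alpha>)\<close>.\<close>
lemma AE_returns_close:
  assumes "similarity_dim \<le> \<alpha>"
  shows "AE x in \<mu>. x \<in> K \<longrightarrow>
    (\<forall>k N. \<exists>n\<ge>N. real n powr (1 / \<alpha>) * \<bar>(T ^^ n) x - x\<bar> \<le> \<rho> ^ k)"
proof -
  have "AE x in \<mu>. x \<in> K \<longrightarrow> (\<exists>n\<ge>N. real n powr (1 / \<alpha>) * \<bar>(T ^^ n) x - x\<bar> \<le> \<rho> ^ k)" for k N
  proof -
    let ?p = "block_start (Suc k) (Suc N)"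
    let ?l = "\<lambda>j. block_length (Suc k) (?p j)"
    have p: "Suc N + j \<le> ?p j" for j by (rule block_start_ge) auto
    then have "0 < ?p j" for j by (rule less_le_trans[rotated]) simp
    then have "AE x in \<mu>. x \<in> K \<longrightarrow> (\<exists>j. returns (?p j) (?l j) (code x))"
      by (intro AE_some_return block_sum_diverges) auto
    then show ?thesis
    proof eventually_elim
      case (elim x)
      show ?case
      proof
        assume x: "x \<in> K"
        then obtain j where j: "returns (?p j) (?l j) (code x)" using elim by blast
        have n: "Suc N \<le> ?p j" using p[of j] by simp
        have "real (?p j) powr (1 / \<alpha>) \<le> real (?p j) powr (1 / similarity_dim)"
          using n assms similarity_dim_pos by (intro powr_mono divide_left_mono) auto
        then have "real (?p j) powr (1 / \<alpha>) * \<bar>(T ^^ ?p j) x - x\<bar> \<le>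
            real (?p j) powr (1 / similarity_dim) * \<bar>(T ^^ ?p j) x - x\<bar>"
          by (rule mult_right_mono) simp
        also have "\<dots> \<le> \<rho> ^ k"
          using return_distance[OF x _ _ j] n by simp
        finally show "\<exists>n\<ge>N. real n powr (1 / \<alpha>) * \<bar>(T ^^ n) x - x\<bar> \<le> \<rho> ^ k"
          using n by (intro exI[of _ "?p j"]) simp
      qed
    qed
  qed
  then have "AE x in \<mu>. \<forall>k N. x \<in> K \<longrightarrow> (\<exists>n\<ge>N. real n powr (1 / \<alpha>) * \<bar>(T ^^ n) x - x\<bar> \<le> \<rho> ^ k)"
    unfolding AE_all_countable by blast
  then show ?thesis by eventually_elim blast
qed

section \<open>The lower limit\<close>

lemma AE_liminf:
  assumes "0 < \<alpha>"
  shows "AE x in \<mu>. x \<in> K \<longrightarrow> liminf (\<lambda>n. ereal (real n powr (1 / \<alpha>) * \<bar>(T ^^ n) x - x\<bar>)) =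
    (if similarity_dim \<le> \<alpha> then 0 else \<infinity>)"
proof (cases "similarity_dim \<le> \<alpha>")
  case True
  show ?thesis using AE_returns_close[OF True]
  proof eventually_elim
    case (elim x)
    show ?case
    proof
      let ?X = "\<lambda>n. real n powr (1 / \<alpha>) * \<bar>(T ^^ n) x - x\<bar>"
      assume x: "x \<in> K"
      have "0 \<le> liminf (\<lambda>n. ereal (?X n))"
        by (intro Liminf_bounded always_eventually) simp
      moreover have "\<not> 0 < liminf (\<lambda>n. ereal (?X n))"
      proof
        assume "0 < liminf (\<lambda>n. ereal (?X n))"
        then obtain e where e: "0 < ereal e" "ereal e < liminf (\<lambda>n. ereal (?X n))"
          using ereal_dense2 by blast
        then obtain k where k: "\<rho> ^ k < e" using exists_rho_power_less by auto
        have "eventually (\<lambda>n. ereal e < ereal (?X n)) sequentially"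
          using e(2) by (rule less_LiminfD)
        then obtain N where "\<And>n. N \<le> n \<Longrightarrow> e < ?X n"
          by (auto simp: eventually_sequentially)
        moreover obtain n where "N \<le> n" "?X n \<le> \<rho> ^ k" using elim x by blast
        ultimately show False using k by fastforce
      qed
      ultimately have "liminf (\<lambda>n. ereal (?X n)) = 0"
        by (intro antisym) (simp_all only: not_less)
      then show "liminf (\<lambda>n. ereal (?X n)) = (if similarity_dim \<le> \<alpha> then 0 else \<infinity>)"
        by (simp only: True if_True)
    qed
  qed
next
  case False
  have "AE x in \<mu>. \<forall>C. x \<in> K \<longrightarrow>
      eventually (\<lambda>n. real (Suc C) < real n powr (1 / \<alpha>) * \<bar>(T ^^ n) x - x\<bar>) sequentially"
    unfolding AE_all_countable using False assms
    by (intro allI AE_returns_eventually_far) auto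
  then show ?thesis
  proof eventually_elim
    case (elim x)
    show ?case
    proof
      let ?X = "\<lambda>n. real n powr (1 / \<alpha>) * \<bar>(T ^^ n) x - x\<bar>"
      assume x: "x \<in> K"
      have "\<infinity> \<le> liminf (\<lambda>n. ereal (?X n))"
        unfolding le_Liminf_iff
      proof (intro allI impI)
        fix y :: ereal assume "y < \<infinity>"
        then have "\<exists>C. y < ereal (real C)"
          using less_PInf_Ex_of_nat[of y] by (simp add: less_top)
        then obtain C where C: "y \<le> ereal (real C)"
          by (auto dest: less_imp_le)
        have "eventually (\<lambda>n. real (Suc C) < ?X n) sequentially" using elim x by blast
        then show "eventually (\<lambda>n. y < ereal (?X n)) sequentially"
        proof eventually_elim
          case (elim n)
          then have "ereal (real C) < ereal (?X n)" by simp
          with C show ?case by (rule le_less_trans)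
        qed
      qed
      then show "liminf (\<lambda>n. ereal (?X n)) = (if similarity_dim \<le> \<alpha> then 0 else \<infinity>)"
        using False by simp
    qed
  qed
qed

end


context homogeneous_ifs
begin

section \<open>The Hausdorff dimension of the attractor\<close>

text \<open>The cylinders of order \<open>n\<close>, one for each word of length \<open>n\<close>, numbered by \<open>h\<close> and followed by
  empty sets to form a sequence.\<close>
lemma cylinder_cover:
  obtains U :: "nat \<Rightarrow> real set" where
    "K \<subseteq> (\<Union>i. U i)" "\<And>i. bounded (U i)" "\<And>i. diameter (U i) \<le> \<rho> ^ n"
    "\<And>i. L ^ n \<le> i \<Longrightarrow> U i = {}"
proof -
  define W where "W = {..<n} \<rightarrow>\<^sub>E {1..L}"
  have W: "finite W" "card W = L ^ n"
    unfolding W_def by (auto simp: finite_PiE card_funcsetE)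
  obtain h where h: "bij_betw h {0..<card W} W"
    using ex_bij_betw_nat_finite[OF W(1)] by blast
  define U where "U i = (if i < L ^ n then {y \<in> K. \<forall>m<n. code y m = h i m} else {})" for i
  show ?thesis
  proof
    show "K \<subseteq> (\<Union>i. U i)"
    proof
      fix y assume y: "y \<in> K"
      then have "restrict (code y) {..<n} \<in> W"
        unfolding W_def by (intro restrict_PiE_iff[THEN iffD2] ballI letter_range)
      then obtain i where i: "i < L ^ n" "h i = restrict (code y) {..<n}"
        using h W(2) by (metis atLeastLessThan_iff bij_betw_imp_surj_on imageE)
      then have "y \<in> U i" using y by (simp add: U_def)
      then show "y \<in> (\<Union>i. U i)" by blast
    qed
    have sub: "U i \<subseteq> K" for i by (auto simp: U_def)
    show "bounded (U i)" for i
      by (rule bounded_subset[OF compact_imp_bounded[OF K_facts(2)] sub])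
    show "diameter (U i) \<le> \<rho> ^ n" for i
    proof (rule diameter_le)
      show "U i \<noteq> {} \<or> 0 \<le> \<rho> ^ n" using rho_pos by simp
      fix x y assume xy: "x \<in> U i" "y \<in> U i"
      then have "code x m = code y m" if "m < n" for m
        using that by (simp add: U_def split: if_splits)
      then show "norm (x - y) \<le> \<rho> ^ n"
        unfolding real_norm_def using xy sub by (intro dist_le_if_codes_agree) auto
    qed
    show "U i = {}" if "L ^ n \<le> i" for i using that by (simp add: U_def)
  qed
qed

lemma hausdorff_pre_le:
  assumes "\<rho> ^ n \<le> \<delta>" "0 < s"
  shows "hausdorff_pre \<delta> s K \<le> ennreal ((real L * \<rho> powr s) ^ n)"
proof -
  obtain U :: "nat \<Rightarrow> real set" where U: "K \<subseteq> (\<Union>i. U i)" "\<And>i. bounded (U i)"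
    "\<And>i. diameter (U i) \<le> \<rho> ^ n" "\<And>i. L ^ n \<le> i \<Longrightarrow> U i = {}"
    using cylinder_cover by blast
  have "hausdorff_pre \<delta> s K \<le> (\<Sum>i. ennreal (diameter (U i) powr s))"
    unfolding hausdorff_pre_def
    by (rule INF_lower) (use U order.trans[OF U(3) assms(1)] in blast)
  also have "\<dots> = (\<Sum>i<L ^ n. ennreal (diameter (U i) powr s))"
    by (rule suminf_finite) (use U(4) in \<open>auto simp: not_less\<close>)
  also have "\<dots> \<le> (\<Sum>i<L ^ n. ennreal ((\<rho> ^ n) powr s))"
    by (intro sum_mono ennreal_leI powr_mono2 U(3) diameter_ge_0 U(2)) (use assms in auto)
  also have "\<dots> = ennreal (real (L ^ n) * (\<rho> ^ n) powr s)"
    by (simp add: ennreal_mult ennreal_of_nat_eq_real_of_nat)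
  also have "real (L ^ n) * (\<rho> ^ n) powr s = (real L * \<rho> powr s) ^ n"
    using rho_pos by (simp add: power_mult_distrib powr_realpow[symmetric] powr_powr mult.commute)
  finally show ?thesis .
qed

text \<open>For \<open>s > \<gamma>\<close> the covering sums \<open>(L * \<rho> powr s) ^ n\<close> decay geometrically.\<close>
lemma hausdorff_measure_zero:
  assumes "similarity_dim < s"
  shows "hausdorff_measure s K = 0"
proof -
  have s: "0 < s" using similarity_dim_pos assms by linarith
  have q: "0 \<le> real L * \<rho> powr s" "real L * \<rho> powr s < 1"
  proof -
    have "\<rho> powr s < \<rho> powr similarity_dim"
      using assms rho_pos rho_less_1 by (intro powr_less_mono') auto
    also have "\<dots> = 1 / real L"
      using rho_powr_dim[of 1] two_le_L by (simp add: powr_minus divide_inverse)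
    finally show "real L * \<rho> powr s < 1"
      using two_le_L by (simp add: field_simps)
  qed simp
  have "hausdorff_pre \<delta> s K \<le> 0" if "0 < \<delta>" for \<delta>
  proof (rule tendsto_lowerbound)
    show "((\<lambda>n. ennreal ((real L * \<rho> powr s) ^ n)) \<longlonglongrightarrow> 0)"
      using tendsto_ennrealI[OF LIMSEQ_power_zero[of "real L * \<rho> powr s"]] q by simp
    have "eventually (\<lambda>n. \<rho> ^ n < \<delta>) sequentially"
      using LIMSEQ_power_zero[of \<rho>] rho_pos rho_less_1 that by (intro order_tendstoD(2)) auto
    then show "eventually (\<lambda>n. hausdorff_pre \<delta> s K \<le> ennreal ((real L * \<rho> powr s) ^ n)) sequentially"
      by eventually_elim (intro hausdorff_pre_le s, simp)
  qed simp
  then show ?thesis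
    unfolding hausdorff_measure_def by (simp add: SUP_eq_const bot_ennreal le_zero_eq)
qed

end

context self_similar_measure
begin

text \<open>The points of \<open>K\<close> in \<open>V\<close> lie in one cylinder of the order adapted to the diameter of \<open>V\<close>. If the
  diameter is zero, there is at most one such point, and it lies in cylinders of every order.\<close>
lemma measure_closed_le:
  assumes "closed V" "bounded V"
  shows "prob V \<le> real L * (diameter V / gap) powr similarity_dim"
proof (cases "V \<inter> K = {}")
  case True
  have "prob V = prob {}"
    by (rule finite_measure_eq_AE)
      (use AE_in_K True assms(1) in \<open>auto simp: sets_mu elim!: eventually_mono\<close>)
  then show ?thesis by simp
next
  case False
  then obtain x where x: "x \<in> V" "x \<in> K" by blast
  have near: "\<bar>y - x\<bar> \<le> diameter V" if "y \<in> V" for y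
    using diameter_bounded_bound[OF assms(2) that x(1)] by (simp add: dist_real_def)
  have cyl: "prob V \<le> 1 / real L ^ m"
    if "\<And>y. y \<in> V \<Longrightarrow> y \<in> K \<Longrightarrow> \<forall>i<m. code y i = code x i" for m
  proof -
    have E: "event (\<lambda>c. \<forall>i<m. c i = code x i) \<in> sets \<mu>"
      by (rule event_sets[of m]) (simp add: depends_below_def)
    have "AE y in \<mu>. y \<in> V \<longrightarrow> y \<in> event (\<lambda>c. \<forall>i<m. c i = code x i)"
      using AE_in_K by eventually_elim (use that in \<open>auto simp: event_def\<close>)
    from finite_measure_mono_AE[OF this E] show ?thesis
      using code_prob_cylinder[OF coding_in_code_space[OF x(2)]] by simp
  qed
  show ?thesis
  proof (cases "diameter V = 0")
    case True
    have "V \<subseteq> {x}" using near True by fastforce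
    then have "prob V \<le> 1 / real L ^ m" for m
      by (intro cyl) blast
    moreover have "(\<lambda>m. 1 / real L ^ m) \<longlonglongrightarrow> 0"
      using two_le_L LIMSEQ_inverse_realpow_zero[of "real L"] by (simp add: divide_inverse)
    ultimately have "prob V \<le> 0" by (intro LIMSEQ_le_const) auto
    then show ?thesis using True by simp
  next
    case False
    then have "0 < diameter V" using diameter_ge_0[OF assms(2)] by linarith
    then obtain m where m: "\<forall>x\<in>K. \<forall>y\<in>K. \<bar>x - y\<bar> \<le> diameter V \<longrightarrow> (\<forall>i<m. code x i = code y i)"
      "1 / real L ^ m \<le> real L * (diameter V / gap) powr similarity_dim"
      using exists_scale by blast
    have "prob V \<le> 1 / real L ^ m"
      by (rule cyl) (use m(1) near x(2) in blast)
    also note m(2)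
    finally show ?thesis .
  qed
qed

text \<open>The mass distribution principle. The sets of a cover are replaced by their closures, which have
  the same diameter and are measurable. Covers by sets of diameter at most \<open>1\<close> suffice, and for those
  \<open>diameter U powr \<gamma> \<le> diameter U powr s\<close>.\<close>
lemma hausdorff_measure_pos:
  assumes "0 < s" "s \<le> similarity_dim"
  shows "hausdorff_measure s K \<noteq> 0"
proof -
  define C where "C = real L * (1 / gap) powr similarity_dim"
  have C: "0 < C" using two_le_L gap_pos by (simp add: C_def)
  have "ennreal (1 / C) \<le> (\<Sum>i. ennreal (diameter (U i) powr s))"
    if U: "K \<subseteq> (\<Union>i. U i)" "\<And>i. bounded (U i)" "\<And>i. diameter (U i) \<le> 1" for U :: "nat \<Rightarrow> real set"
  proof -
    have piece: "emeasure \<mu> (closure (U i)) \<le> ennreal C * ennreal (diameter (U i) powr s)" for i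
    proof -
      have "prob (closure (U i)) \<le> real L * (diameter (U i) / gap) powr similarity_dim"
        using measure_closed_le[of "closure (U i)"] U(2) by (simp add: diameter_closure bounded_closure)
      also have "(diameter (U i) / gap) powr similarity_dim =
          (1 / gap) powr similarity_dim * diameter (U i) powr similarity_dim"
        using powr_mult[of "1 / gap" "diameter (U i)" similarity_dim] by simp
      finally have "prob (closure (U i)) \<le> C * diameter (U i) powr similarity_dim"
        by (simp add: C_def mult.assoc)
      also have "\<dots> \<le> C * diameter (U i) powr s"
        using assms(2) U(3) diameter_ge_0[OF U(2)] C by (intro mult_left_mono powr_mono') auto
      finally show ?thesis
        using C by (simp add: emeasure_eq_measure ennreal_mult[symmetric] ennreal_leI)
    qed
    have "1 = emeasure \<mu> K" using measure_K by (simp add: emeasure_eq_measure)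
    also have "\<dots> \<le> emeasure \<mu> (\<Union>i. closure (U i))"
    proof (rule emeasure_mono)
      show "K \<subseteq> (\<Union>i. closure (U i))"
        by (rule order.trans[OF U(1) UN_mono[OF order.refl closure_subset]])
      show "(\<Union>i. closure (U i)) \<in> sets \<mu>"
        unfolding sets_mu by (intro sets.countable_UN' borel_closed) auto
    qed
    also have "\<dots> \<le> (\<Sum>i. emeasure \<mu> (closure (U i)))"
      by (rule emeasure_subadditive_countably) (auto simp: sets_mu)
    also have "\<dots> \<le> (\<Sum>i. ennreal C * ennreal (diameter (U i) powr s))"
      by (intro suminf_le piece) auto
    also have "\<dots> = ennreal C * (\<Sum>i. ennreal (diameter (U i) powr s))"
      by (rule ennreal_suminf_cmult)
    finally have "ennreal (1 / C) * 1 \<le> ennreal (1 / C) * (ennreal C * (\<Sum>i. ennreal (diameter (U i) powr s)))"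
      by (rule mult_left_mono) simp
    then show ?thesis
      using C by (simp add: mult.assoc[symmetric] ennreal_mult[symmetric])
  qed
  then have "ennreal (1 / C) \<le> hausdorff_pre 1 s K"
    unfolding hausdorff_pre_def by (intro INF_greatest) blast
  also have "\<dots> \<le> hausdorff_measure s K"
    unfolding hausdorff_measure_def by (rule SUP_upper) simp
  finally show ?thesis using C by (auto simp: ennreal_eq_0_iff)
qed

lemma hausdorff_dim_K: "hausdorff_dim K = ereal similarity_dim"
proof -
  have iff: "0 < s \<and> hausdorff_measure s K = 0 \<longleftrightarrow> similarity_dim < s" for s
    using hausdorff_measure_zero hausdorff_measure_pos similarity_dim_pos
    by (meson less_trans not_le)
  show ?thesis
    unfolding hausdorff_dim_def iff
  proof (rule Inf_eqI)
    show "\<And>y. y \<in> {ereal s |s. similarity_dim < s} \<Longrightarrow> ereal similarity_dim \<le> y" by auto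
    fix y :: ereal assume y: "\<And>i. i \<in> {ereal s |s. similarity_dim < s} \<Longrightarrow> y \<le> i"
    show "y \<le> ereal similarity_dim"
    proof (rule ccontr)
      assume "\<not> y \<le> ereal similarity_dim"
      then obtain s where "ereal similarity_dim < ereal s" "ereal s < y"
        using ereal_dense2 by (metis not_le)
      with y[of "ereal s"] show False by auto
    qed
  qed
qed

end

section \<open>The recurrence dichotomy\<close>

theorem corollary1p6:
  fixes L :: nat and \<rho> \<alpha> :: real and a :: "nat \<Rightarrow> real"
    and K :: "real set" and \<mu> :: "real measure"
  assumes "L \<ge> 2" and "0 < \<rho>" and "\<rho> < 1"
    and "0 \<le> a 1" and "strict_mono_on {1..L} a" and "a L \<le> 1 - \<rho>"
    and "is_attractor L (ifs_map \<rho> a) K"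
    and "strong_separation L (ifs_map \<rho> a) K"
    and "is_natural_measure L (ifs_map \<rho> a) K \<mu>"
    and "\<alpha> > 0"
  shows "hausdorff_dim K = ereal (ln (real L) / (- ln \<rho>)) \<and>
    (AE x in \<mu>. x \<in> K \<longrightarrow>
       liminf (\<lambda>n. ereal (real n powr (1 / \<alpha>) * \<bar>((shift_map L (ifs_map \<rho> a)) ^^ n) x - x\<bar>))
       = (if ereal \<alpha> \<ge> hausdorff_dim K then 0 else \<infinity>))"
proof -
  have mono: "a i \<le> a j" if "i \<in> {1..L}" "j \<in> {1..L}" "i \<le> j" for i j
    using strict_mono_on_leD[OF assms(5)] that by blast
  interpret self_similar_measure L \<rho> a K \<mu>
  proof
    fix j assume j: "j \<in> {1..L}"
    then have "a 1 \<le> a j" "a j \<le> a L" by (auto intro!: mono)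
    with assms show "0 \<le> a j \<and> a j \<le> 1 - \<rho>" by linarith
  qed (use assms in auto)
  show ?thesis
    using hausdorff_dim_K AE_liminf[OF assms(10)] by (simp add: similarity_dim_def)
qed

end
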